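(* Let $n\ge 1$. Fix a total order $<$ on $\mathcal{W}_n$ that extends the partial order $\preceq$ of the web graph and respects nesting numbers, meaning that $n(\tilde w)<n(w')$ implies $\tilde w<w'$. Order the web basis of $V^{\mathcal{W}_n}$ by $<$ and the Specht basis of $V^{\mathcal{T}_n}$ correspondingly via the bijection $\psi:\mathcal{T}_n\to\mathcal{W}_n$. Then the matrix of $\phi:V^{\mathcal{T}_n}\to V^{\mathcal{W}_n}$ in these ordered bases is upper-triangular with ones along the diagonal. That is, writing $\phi(v_{T'})=\sum_{w\in\mathcal{W}_n}c_w^{w'}w$ for $T'\in\mathcal{T}_n$ and $w'=\psi(T')$, one has $c_{w'}^{w'}=1$, and $c_w^{w'}=0$ unless $w\le w'$.
   Context: $\mathcal{T}_n$ is the set of standard Young tableaux of shape $(n,n)$ ($2\times n$ fillings with $1,\dots,2n$, increasing along rows and down columns). $s_i\in S_{2n}$ is the transposition of $i$ and $i+1$; $S_{2n}$ acts on tableaux by permuting entries. Specht module: a tabloid $\{T\}$ is the equivalence class of a tableau $T$ under reordering entries within rows. For any tableau $T$ of shape $(n,n)$, $v_T=\sum_{\sigma\in Col(T)}\mathrm{sign}(\sigma)\{\sigma\cdot T\}$, where $Col(T)$ is the group of permutations preserving each column of $T$ setwise. $V^{\mathcal{T}_n}$ is the complex span of all the $v_T$; it has basis $\{v_T: T\in\mathcal{T}_n\}$ (the Specht basis), and $\sigma\cdot v_T=v_{\sigma\cdot T}$. A web on $2n$ points is a noncrossing perfect matching of $1,\dots,2n$ (arcs above a horizontal axis); $(i,j)$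 denotes an arc with endpoints $i<j$, and $\{i,j\}$ an arc whose endpoints are not necessarily listed in order. $\mathcal{W}_n$ is the set of webs and $V^{\mathcal{W}_n}$ the complex vector space with basis $\mathcal{W}_n$, with the $S_{2n}$-action: $s_i\cdot w=-w$ if $(i,i+1)$ is an arc of $w$; otherwise, if $w$ contains $\{i,j\}$ and $\{i+1,k\}$, then $s_i\cdot w=w+w'$ where $w'$ is obtained from $w$ by replacing these two arcs by $(i,i+1)$ and $\{j,k\}$. Tableau graph: directed graph on $\mathcal{T}_n$ with an edge $T\stackrel{s_i}{\longrightarrow}T'$ iff $s_i\cdot T=T'$ and $i$ is in the second row and $i+1$ in the first row of $T$. Web graph: directed graph on $\mathcal{W}_n$ with an edge $w\stackrel{s_i}{\longrightarrow}w'$ iff $s_i\cdot w=w+w'$ and $w$ contains arcs $(j,i)$ and $(i+1,k)$ with $j<i<i+1<k$. The web graph is acyclic; $w\preceq w'$ means there is a (possibly empty) directed path from $w$ to $w'$ in the web graph. The bijection $\psi:\mathcal{T}_n\to\mathcal{W}_n$: process the bottom row of $T$ from left to right, joining each entry's vertex by an arc to the nearest not-yet-matched vertex to its left. Nesting number: for an arc $a$ of $w$, $n(a)$ is the number of arcs of $w$ that $a$ is nested beneath ($(r,s)$ is nested beneath $(r',s')$ if $r'<r<s<s'$); $n(w)=\sum_{a}n(a)$ over all arcs of $w$. $T_0\in\mathcal{T}_n$ has top row $1,3,\dots,2n-1$ and bottom row $2,4,\dots,2n$; $w_0$ is the web with arcs $(1,2),(3,4),\dots,(2n-1,2n)$.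 The linear map $\phi$ is defined by $\phi(v_T)=\sigma\cdot w_0$, where $\sigma$ is the product of the edge labels of a directed path from $T_0$ to $T$ in the tableau graph, composed so that $\sigma\cdot T_0=T$ (the label of the first edge acts first); such a path always exists and the result does not depend on its choice. *)

theory Defs
  imports Complex_Main "HOL-Library.Poly_Mapping" "HOL-Combinatorics.Permutations"
begin

section \<open>Free complex vector spaces\<close>

text \<open>\<^typ>\<open>'a \<Rightarrow>\<^sub>0 complex\<close> is the complex vector space with basis \<^typ>\<open>'a\<close>;
  coordinates are given by \<^const>\<open>Poly_Mapping.lookup\<close>. The library provides its additive structure only.\<close>

definition cscale :: "complex \<Rightarrow> ('a \<Rightarrow>\<^sub>0 complex) \<Rightarrow> ('a \<Rightarrow>\<^sub>0 complex)"  (infixr \<open>*\<^sub>c\<close> 75)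
  where "c *\<^sub>c x = Poly_Mapping.map ((*) c) x"

lemma lookup_cscale [simp]: "Poly_Mapping.lookup (c *\<^sub>c x) a = c * Poly_Mapping.lookup x a"
  by (cases "Poly_Mapping.lookup x a = 0") (simp_all add: cscale_def Poly_Mapping.map.rep_eq)

lemma vector_space_cscale: "vector_space (cscale :: complex \<Rightarrow> ('a \<Rightarrow>\<^sub>0 complex) \<Rightarrow> _)"
  by unfold_locales (auto intro!: poly_mapping_eqI simp: lookup_add algebra_simps)

global_interpretation free: vector_space_pair
    "cscale :: complex \<Rightarrow> ('a \<Rightarrow>\<^sub>0 complex) \<Rightarrow> _"
    "cscale :: complex \<Rightarrow> ('b \<Rightarrow>\<^sub>0 complex) \<Rightarrow> _"
  by (intro vector_space_pair.intro vector_space_cscale)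

abbreviation basis_vec :: "'a \<Rightarrow> ('a \<Rightarrow>\<^sub>0 complex)"
  where "basis_vec a \<equiv> Poly_Mapping.single a 1"

section \<open>Tableaux and Specht vectors\<close>

text \<open>A two-row filling is the pair (top row, bottom row).\<close>

type_synonym tableau = "nat list \<times> nat list"

definition tableau :: "nat \<Rightarrow> tableau \<Rightarrow> bool" where
  "tableau n T \<longleftrightarrow> length (fst T) = n \<and> length (snd T) = n \<and>
     distinct (fst T @ snd T) \<and> set (fst T @ snd T) = {1..2*n}"

definition syt :: "nat \<Rightarrow> tableau set" where
  "syt n = {T. tableau n T \<and> sorted_wrt (<) (fst T) \<and> sorted_wrt (<) (snd T) \<and>
     (\<forall>j<n. fst T ! j < snd T ! j)}"

definition perm_tableau :: "(nat \<Rightarrow> nat) \<Rightarrow> tableau \<Rightarrow> tableau" where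
  "perm_tableau \<sigma> T = (map \<sigma> (fst T), map \<sigma> (snd T))"

definition tabloid :: "tableau \<Rightarrow> tableau set" where
  "tabloid T = {T'. mset (fst T') = mset (fst T) \<and> mset (snd T') = mset (snd T)}"

definition Col :: "nat \<Rightarrow> tableau \<Rightarrow> (nat \<Rightarrow> nat) set" where
  "Col n T = {\<sigma>. \<sigma> permutes {1..2*n} \<and>
     (\<forall>j<n. \<sigma> ` {fst T ! j, snd T ! j} = {fst T ! j, snd T ! j})}"

definition specht :: "nat \<Rightarrow> tableau \<Rightarrow> (tableau set \<Rightarrow>\<^sub>0 complex)" where
  "specht n T = (\<Sum>\<sigma>\<in>Col n T. of_int (sign \<sigma>) *\<^sub>c basis_vec (tabloid (perm_tableau \<sigma> T)))"

definition specht_module :: "nat \<Rightarrow> (tableau set \<Rightarrow>\<^sub>0 complex) set" where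
  "specht_module n = free.vs1.span (specht n ` {T. tableau n T})"

definition tableau_edge :: "nat \<Rightarrow> nat \<Rightarrow> tableau \<Rightarrow> tableau \<Rightarrow> bool" where
  "tableau_edge n i T T' \<longleftrightarrow> T \<in> syt n \<and> T' \<in> syt n \<and> i \<in> {1..<2*n} \<and>
     perm_tableau (transpose i (i+1)) T = T' \<and> i \<in> set (snd T) \<and> i+1 \<in> set (fst T)"

text \<open>\<open>tableau_path n T ls T'\<close>: a directed path from \<open>T\<close> to \<open>T'\<close> whose successive edge labels
  are \<open>s\<^sub>i\<close> for \<open>i\<close> in the list \<open>ls\<close>, first edge first.\<close>

inductive tableau_path :: "nat \<Rightarrow> tableau \<Rightarrow> nat list \<Rightarrow> tableau \<Rightarrow> bool" for n T where
  "T \<in> syt n \<Longrightarrow> tableau_path n T [] T"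
| "tableau_path n T ls T' \<Longrightarrow> tableau_edge n i T' T'' \<Longrightarrow> tableau_path n T (ls @ [i]) T''"

definition T0 :: "nat \<Rightarrow> tableau" where
  "T0 n = (map (\<lambda>i. 2*i+1) [0..<n], map (\<lambda>i. 2*i+2) [0..<n])"

section \<open>Webs\<close>

text \<open>A web is the set of its arcs, each arc being listed with its left endpoint first.\<close>

type_synonym web = "(nat \<times> nat) set"

definition webs :: "nat \<Rightarrow> web set" where
  "webs n = {w. (\<forall>(i,j)\<in>w. 1 \<le> i \<and> i < j \<and> j \<le> 2*n) \<and>
     (\<forall>k\<in>{1..2*n}. \<exists>!a. a \<in> w \<and> (k = fst a \<or> k = snd a)) \<and>
     (\<forall>(i,j)\<in>w. \<forall>(k,l)\<in>w. \<not> (i < k \<and> k < j \<and> j < l))}"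

definition web_space :: "nat \<Rightarrow> (web \<Rightarrow>\<^sub>0 complex) set" where
  "web_space n = free.vs1.span (basis_vec ` webs n)"

definition arc :: "nat \<Rightarrow> nat \<Rightarrow> nat \<times> nat" where
  "arc i j = (min i j, max i j)"

definition partner :: "web \<Rightarrow> nat \<Rightarrow> nat" where
  "partner w i = (THE j. arc i j \<in> w)"

definition rejoin :: "nat \<Rightarrow> web \<Rightarrow> web" where
  "rejoin i w = (let j = partner w i; k = partner w (i+1) in
     (w - {arc i j, arc (i+1) k}) \<union> {(i, i+1), arc j k})"

definition s_web :: "nat \<Rightarrow> web \<Rightarrow> (web \<Rightarrow>\<^sub>0 complex)" where
  "s_web i w = (if (i, i+1) \<in> w then - basis_vec w else basis_vec w + basis_vec (rejoin i w))"

definition s_act :: "nat \<Rightarrow> (web \<Rightarrow>\<^sub>0 complex) \<Rightarrow> (web \<Rightarrow>\<^sub>0 complex)" where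
  "s_act i x = (\<Sum>w\<in>Poly_Mapping.keys x. Poly_Mapping.lookup x w *\<^sub>c s_web i w)"

text \<open>The action of \<open>s\<^bsub>i\<^sub>k\<^esub> \<cdots> s\<^bsub>i\<^sub>1\<^esub>\<close> for the word \<open>[i\<^sub>1, \<dots>, i\<^sub>k]\<close>: since \<^const>\<open>fold\<close> processes its list
  from the left, \<open>i\<^sub>1\<close> acts first.\<close>

definition word_act :: "nat list \<Rightarrow> (web \<Rightarrow>\<^sub>0 complex) \<Rightarrow> (web \<Rightarrow>\<^sub>0 complex)" where
  "word_act ls x = fold s_act ls x"

definition web_edge :: "nat \<Rightarrow> nat \<Rightarrow> web \<Rightarrow> web \<Rightarrow> bool" where
  "web_edge n i w w' \<longleftrightarrow> w \<in> webs n \<and> w' \<in> webs n \<and> i \<in> {1..<2*n} \<and>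
     s_act i (basis_vec w) = basis_vec w + basis_vec w' \<and>
     (\<exists>j k. (j, i) \<in> w \<and> (i+1, k) \<in> w \<and> j < i \<and> i+1 < k)"

definition web_le :: "nat \<Rightarrow> web \<Rightarrow> web \<Rightarrow> bool" where
  "web_le n = (\<lambda>w w'. \<exists>i. web_edge n i w w')\<^sup>*\<^sup>*"

definition nested :: "web \<Rightarrow> nat \<times> nat \<Rightarrow> nat" where
  "nested w a = card {b \<in> w. fst b < fst a \<and> fst a < snd a \<and> snd a < snd b}"

definition nesting :: "web \<Rightarrow> nat" where
  "nesting w = (\<Sum>a\<in>w. nested w a)"

definition w0 :: "nat \<Rightarrow> web" where
  "w0 n = (\<lambda>i. (2*i+1, 2*i+2)) ` {..<n}"

section \<open>The bijection between tableaux and webs, and the linear map\<close>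

definition psi :: "tableau \<Rightarrow> web" where
  "psi T = fold (\<lambda>b w. insert (Max {a. 1 \<le> a \<and> a < b \<and> a \<notin> fst ` w \<union> snd ` w}, b) w) (snd T) {}"

text \<open>A path from \<open>T0 n\<close> to each \<open>T \<in> syt n\<close> exists, and the value does not depend on the one
  chosen by \<open>SOME\<close>.\<close>

definition phi_val :: "nat \<Rightarrow> tableau \<Rightarrow> (web \<Rightarrow>\<^sub>0 complex)" where
  "phi_val n T = word_act (SOME ls. tableau_path n (T0 n) ls T) (basis_vec (w0 n))"

text \<open>The linear map sending the Specht basis vector of \<open>T \<in> syt n\<close> to \<open>phi_val n T\<close>. As a total
  function on the tabloid space it is meaningful only as a map from \<^term>\<open>specht_module n\<close>
  to \<^term>\<open>web_space n\<close>.\<close>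

definition phi :: "nat \<Rightarrow> (tableau set \<Rightarrow>\<^sub>0 complex) \<Rightarrow> (web \<Rightarrow>\<^sub>0 complex)" where
  "phi n = free.construct (specht n ` syt n) (\<lambda>v. phi_val n (inv_into (syt n) (specht n) v))"

end

theory Submission
  imports Defs
begin

text \<open>
  Nesting numbers grade the web graph. If \<open>w\<close> contains \<open>(j, i)\<close> and \<open>(i+1, k)\<close>, then rejoining at \<open>i\<close>
  yields \<open>(i, i+1)\<close> beneath \<open>(j, k)\<close>, and every other arc keeps its contribution, so the nesting
  number rises by exactly one. In the two other positions of the arcs at \<open>i\<close> and \<open>i+1\<close>, one of them
  lies beneath the other, and rejoining separates them: the nesting number does not rise. Hence
  \<open>s\<^sub>i\<close> raises nesting numbers by at most one, and a tableau edge \<open>T \<rightarrow> T'\<close> with label \<open>s\<^sub>i\<close> is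
  carried by \<^const>\<open>psi\<close> to a step from \<open>psi T\<close> to \<open>rejoin i (psi T)\<close> that raises it by exactly one.

  Along a path in the tableau graph this gives, by induction, a statement stronger than
  triangularity: \<open>phi_val n T\<close> is \<open>psi T\<close> plus a combination of webs with strictly smaller nesting
  number (\<open>leading_word_act\<close>). If all other terms have nesting number below \<open>nesting (psi T)\<close>, then
  after applying \<open>s\<^sub>i\<close> they contribute only webs of nesting number at most \<open>nesting (psi T)\<close>, and
  \<open>psi T\<close> itself contributes \<open>psi T + rejoin i (psi T)\<close>; so \<open>psi T' = rejoin i (psi T)\<close> is the only
  term of nesting number \<open>nesting (psi T) + 1\<close>, and its coefficient is one (\<open>leading_s_act\<close>).
  Since the total order respects nesting numbers, this is upper triangularity.

  Three more facts connect this induction with the map \<^const>\<open>phi\<close>. The Specht vectors of standard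
  tableaux are linearly independent, so \<^const>\<open>phi\<close> takes its prescribed value on each of them
  (\<open>phi_specht\<close>). Every standard tableau is reached by a path from \<^term>\<open>T0 n\<close>
  (\<open>tableau_path_exists\<close>). A web is recovered by \<^const>\<open>psi\<close> from its set of right endpoints
  (\<open>psi_eqI\<close>), which identifies \<open>psi T'\<close> along an edge without recomputing the matching.
\<close>

section \<open>Noncrossing matchings\<close>

lemma web_bounds:
  assumes "w \<in> webs n" "(a, b) \<in> w"
  shows "1 \<le> a" "a < b" "b \<le> 2*n"
proof -
  have "\<forall>(i,j)\<in>w. 1 \<le> i \<and> i < j \<and> j \<le> 2*n"
    using assms(1)[unfolded webs_def mem_Collect_eq, THEN conjunct1] .
  from bspec[OF this assms(2)] show "1 \<le> a" "a < b" "b \<le> 2*n"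
    by simp_all
qed

lemma web_subset: "w \<in> webs n \<Longrightarrow> w \<subseteq> {1..2*n} \<times> {1..2*n}"
proof
  fix p assume "w \<in> webs n" "p \<in> w"
  then show "p \<in> {1..2*n} \<times> {1..2*n}"
    using web_bounds[of w n "fst p" "snd p"] by (cases p) auto
qed

lemma finite_web: "w \<in> webs n \<Longrightarrow> finite w"
  by (rule finite_subset[OF web_subset]) auto

lemma finite_webs: "finite (webs n)"
  by (rule finite_subset[of _ "Pow ({1..2*n} \<times> {1..2*n})"]) (use web_subset in auto)

lemma web_noncrossing:
  assumes "w \<in> webs n" "(a, b) \<in> w" "(c, d) \<in> w"
  shows "\<not> (a < c \<and> c < b \<and> b < d)"
proof -
  have "\<forall>(i,j)\<in>w. \<forall>(k,l)\<in>w. \<not> (i < k \<and> k < j \<and> j < l)"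
    using assms(1)[unfolded webs_def mem_Collect_eq, THEN conjunct2, THEN conjunct2] .
  from bspec[OF this assms(2)] have "\<forall>(k,l)\<in>w. \<not> (a < k \<and> k < b \<and> b < l)"
    by simp
  from bspec[OF this assms(3)] show ?thesis
    by simp
qed

lemma web_unique:
  assumes "w \<in> webs n" "p \<in> w" "q \<in> w" "x = fst p \<or> x = snd p" "x = fst q \<or> x = snd q"
  shows "p = q"
proof -
  have "x \<in> {1..2*n}"
    using web_bounds[OF assms(1), of "fst p" "snd p"] assms(2,4) by auto
  with assms(1)[unfolded webs_def mem_Collect_eq, THEN conjunct2, THEN conjunct1]
  have "\<exists>!a. a \<in> w \<and> (x = fst a \<or> x = snd a)"
    by (rule bspec)
  then show ?thesis
    using assms(2-5) by blast
qed

lemma web_arc_disjoint: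
  assumes w: "w \<in> webs n" and "(a, b) \<in> w" "(c, d) \<in> w" "(a, b) \<noteq> (c, d)"
  shows "a \<noteq> c \<and> a \<noteq> d \<and> b \<noteq> c \<and> b \<noteq> d"
  using web_unique[OF w assms(2,3)] assms(4) by auto

lemma web_covers:
  assumes "w \<in> webs n" "x \<in> {1..2*n}"
  obtains p where "p \<in> w" "x = fst p \<or> x = snd p"
proof -
  have "\<exists>!a. a \<in> w \<and> (x = fst a \<or> x = snd a)"
    using assms(1)[unfolded webs_def mem_Collect_eq, THEN conjunct2, THEN conjunct1] assms(2) by (rule bspec)
  then show thesis
    using that by blast
qed

lemma partner_eq:
  assumes "w \<in> webs n" "arc x y \<in> w"
  shows "partner w x = y"
  unfolding partner_def
proof (rule the_equality)
  fix z assume z: "arc x z \<in> w"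
  have "arc x z = arc x y"
    by (rule web_unique[OF assms(1) z assms(2), of x]) (auto simp: arc_def min_def max_def)
  then show "z = y"
    by (auto simp: arc_def min_def max_def split: if_splits)
qed (rule assms(2))

lemma rejoin_eq:
  assumes "w \<in> webs n" "arc i j \<in> w" "arc (i+1) k \<in> w"
  shows "rejoin i w = insert (i, i+1) (insert (arc j k) (w - {arc i j, arc (i+1) k}))"
  using partner_eq[OF assms(1,2)] partner_eq[OF assms(1,3)]
  by (auto simp: rejoin_def Let_def)

text \<open>
  The fourth conceivable position, \<open>(i, j)\<close> and \<open>(k, i+1)\<close>, is excluded: these arcs would cross.
\<close>

lemma rejoin_cases:
  assumes w: "w \<in> webs n" and i: "i \<in> {1..<2*n}" and no: "(i, i+1) \<notin> w"
  obtains (side) j k where "(j, i) \<in> w" "(i+1, k) \<in> w" "j < i" "i+1 < k"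
      "rejoin i w = insert (i, i+1) (insert (j, k) (w - {(j, i), (i+1, k)}))"
  | (right) j k where "(i, j) \<in> w" "(i+1, k) \<in> w" "i+1 < k" "k < j"
      "rejoin i w = insert (i, i+1) (insert (k, j) (w - {(i, j), (i+1, k)}))"
  | (left) j k where "(j, i) \<in> w" "(k, i+1) \<in> w" "k < j" "j < i"
      "rejoin i w = insert (i, i+1) (insert (k, j) (w - {(j, i), (k, i+1)}))"
proof -
  obtain p where p: "p \<in> w" "i = fst p \<or> i = snd p"
    using web_covers[OF w, of i] i by auto
  obtain q where q: "q \<in> w" "i+1 = fst q \<or> i+1 = snd q"
    using web_covers[OF w, of "i+1"] i by auto
  obtain a b where ab: "p = (a, b)" by (cases p)
  obtain c d where cd: "q = (c, d)" by (cases q)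
  have lt: "a < b" "c < d"
    using web_bounds(2)[OF w] p q ab cd by auto
  have ne: "p \<noteq> q"
    using p q ab cd lt no by auto
  have sep: "a \<noteq> c" "a \<noteq> d" "b \<noteq> c" "b \<noteq> d"
    using web_unique[OF w p(1) q(1)] ne ab cd by auto
  have nc: "\<not> (a < c \<and> c < b \<and> b < d)" "\<not> (c < a \<and> a < d \<and> d < b)"
    using web_noncrossing[OF w, of a b c d] web_noncrossing[OF w, of c d a b] p(1) q(1) ab cd by simp_all
  consider "b = i" "c = i+1" | "a = i" "c = i+1" | "b = i" "d = i+1" | "a = i" "d = i+1"
    using p q ab cd by auto
  then show thesis
  proof cases
    case 1
    then have "rejoin i w = insert (i, i+1) (insert (a, d) (w - {(a, i), (i+1, d)}))"
      using rejoin_eq[OF w, of i a d] p q ab cd lt by (simp add: arc_def min_def max_def)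
    then show thesis using side 1 p q ab cd lt by auto
  next
    case 2
    then have "d < b" using nc sep lt by linarith
    moreover have "rejoin i w = insert (i, i+1) (insert (d, b) (w - {(i, b), (i+1, d)}))"
      using rejoin_eq[OF w, of i b d] p q ab cd lt 2 \<open>d < b\<close> by (simp add: arc_def min_def max_def)
    ultimately show thesis using right 2 p q ab cd lt by auto
  next
    case 3
    then have "c < a" using nc sep lt by linarith
    moreover have "rejoin i w = insert (i, i+1) (insert (c, a) (w - {(a, i), (c, i+1)}))"
      using rejoin_eq[OF w, of i a c] p q ab cd lt 3 \<open>c < a\<close> by (simp add: arc_def min_def max_def)
    ultimately show thesis using left 3 p q ab cd lt by auto
  next
    case 4
    then have False using nc sep lt by linarith
    then show thesis ..
  qed
qed

text \<open>
  Suppose a remaining arc crosses the new arc between the former partners of \<open>i\<close> and \<open>i+1\<close>. Its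
  endpoints differ from \<open>i\<close> and \<open>i+1\<close>, and no point lies between these two, so it would already cross
  one of the two removed arcs.
\<close>

lemma rejoin_in_webs:
  assumes w: "w \<in> webs n" and i: "i \<in> {1..<2*n}" and no: "(i, i+1) \<notin> w"
  shows "rejoin i w \<in> webs n"
proof -
  \<comment> \<open>The common part of the three positions: trade \<open>p\<close> and \<open>q\<close> for two arcs on the same four points.\<close>
  have exchange: "insert (i, i+1) (insert (a, b) (w - {p, q})) \<in> webs n"
    if pq: "p \<in> w" "q \<in> w" and ab: "1 \<le> a" "a < b" "b \<le> 2*n"
      and ends: "{fst p, snd p, fst q, snd q} = {i, i+1, a, b}"
      and new: "i \<noteq> a" "i \<noteq> b" "i+1 \<noteq> a" "i+1 \<noteq> b"
      and nc: "\<And>c d. (c, d) \<in> w - {p, q} \<Longrightarrow>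
        {c, d} \<inter> {i, i+1, a, b} = {} \<Longrightarrow> \<not> (a < c \<and> c < b \<and> b < d) \<and> \<not> (c < a \<and> a < d \<and> d < b)"
    for a b p q
  proof -
    let ?R = "w - {p, q}"
    let ?w = "insert (i, i+1) (insert (a, b) ?R)"
    have away: "fst r \<notin> {i, i+1, a, b} \<and> snd r \<notin> {i, i+1, a, b}" if "r \<in> ?R" for r
    proof -
      have r: "r \<in> w" "r \<noteq> p" "r \<noteq> q" using that by auto
      have "fst r \<notin> {fst p, snd p, fst q, snd q}" "snd r \<notin> {fst p, snd p, fst q, snd q}"
        using web_unique[OF w r(1) pq(1)] web_unique[OF w r(1) pq(2)] r(2,3) by auto
      then show ?thesis unfolding ends by simp
    qed
    have kinds: "r = (i, i+1) \<or> r = (a, b) \<or>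
        r \<in> w \<and> fst r \<notin> {i, i+1, a, b} \<and> snd r \<notin> {i, i+1, a, b}" if "r \<in> ?w" for r
      using that away by blast
    have bounds: "\<forall>(c,d)\<in>?w. 1 \<le> c \<and> c < d \<and> d \<le> 2*n"
      using web_bounds[OF w] ab i by auto
    have cover: "\<exists>!r. r \<in> ?w \<and> (x = fst r \<or> x = snd r)" if "x \<in> {1..2*n}" for x
    proof -
      consider "x = i \<or> x = i+1" | "x = a \<or> x = b" | "x \<notin> {i, i+1, a, b}" by auto
      then show ?thesis
      proof cases
        case 1
        have "r = (i, i+1)" if "r \<in> ?w" "x = fst r \<or> x = snd r" for r
          using kinds[OF that(1)] that(2) 1 new by auto
        then show ?thesis
          using 1 by (intro ex1I[of _ "(i, i+1)"]) simp_all
      next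
        case 2
        have "r = (a, b)" if "r \<in> ?w" "x = fst r \<or> x = snd r" for r
          using kinds[OF that(1)] that(2) 2 new by auto
        then show ?thesis
          using 2 by (intro ex1I[of _ "(a, b)"]) simp_all
      next
        case 3
        obtain r where r: "r \<in> w" "x = fst r \<or> x = snd r"
          using web_covers[OF w \<open>x \<in> {1..2*n}\<close>] by blast
        have "r \<in> ?R" using r 3 ends by auto
        moreover have "r' = r" if "r' \<in> ?w" "x = fst r' \<or> x = snd r'" for r'
          using kinds[OF that(1)] that(2) 3 web_unique[OF w _ r(1) _ r(2), of r'] by auto
        ultimately show ?thesis
          using r(2) by (intro ex1I[of _ r]) auto
      qed
    qed
    have nx: "\<not> (c < e \<and> e < d \<and> d < f)" if "(c, d) \<in> ?w" "(e, f) \<in> ?w" for c d e f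
    proof -
      have "(c, d) = (i, i+1) \<or> (c, d) = (a, b) \<or> (c, d) \<in> ?R"
        using that(1) unfolding insert_iff .
      moreover have "(e, f) = (i, i+1) \<or> (e, f) = (a, b) \<or> (e, f) \<in> ?R"
        using that(2) unfolding insert_iff .
      moreover have ?thesis if "(c, d) = (i, i+1)"
        using that by auto
      moreover have ?thesis if "(e, f) = (i, i+1)" "(c, d) = (a, b)"
        using that new by auto
      moreover have ?thesis if "(e, f) = (i, i+1)" "(c, d) \<in> ?R"
        using away[OF that(2)] that(1) by auto
      moreover have ?thesis if "(c, d) = (a, b)" "(e, f) \<in> ?R"
      proof -
        have "{e, f} \<inter> {i, i+1, a, b} = {}"
          using away[OF that(2)] by simp
        from nc[OF that(2) this] that(1) show ?thesis by simp
      qed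
      moreover have ?thesis if "(e, f) = (a, b)" "(c, d) \<in> ?R"
      proof -
        have "{c, d} \<inter> {i, i+1, a, b} = {}"
          using away[OF that(2)] by simp
        from nc[OF that(2) this] that(1) show ?thesis by simp
      qed
      moreover have ?thesis if "(c, d) = (a, b)" "(e, f) = (a, b)"
        using that by auto
      moreover have ?thesis if "(c, d) \<in> ?R" "(e, f) \<in> ?R"
        using web_noncrossing[OF w, of c d e f] that by simp
      ultimately show ?thesis
        by argo
    qed
    show ?thesis
      unfolding webs_def mem_Collect_eq
    proof (intro conjI)
      show "\<forall>(c,d)\<in>?w. \<forall>(e,f)\<in>?w. \<not> (c < e \<and> e < d \<and> d < f)"
      proof (rule ballI, rule case_prodI2, rule ballI, rule case_prodI2)
        fix p q c d e f assume "p \<in> ?w" "p = (c, d)" "q \<in> ?w" "q = (e, f)"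
        then show "\<not> (c < e \<and> e < d \<and> d < f)" by (intro nx) simp_all
      qed
      show "\<forall>x\<in>{1..2*n}. \<exists>!r. r \<in> ?w \<and> (x = fst r \<or> x = snd r)"
        using cover by (rule ballI)
    qed (rule bounds)
  qed
  have nc: "\<not> (a < c \<and> c < b \<and> b < d) \<and> \<not> (c < a \<and> a < d \<and> d < b)" if "(a, b) \<in> w" "(c, d) \<in> w" for a b c d
    using web_noncrossing[OF w that] web_noncrossing[OF w that(2,1)] by (rule conjI)
  from w i no show ?thesis
  proof (cases rule: rejoin_cases)
    case (side j k)
    show ?thesis unfolding side(5)
    proof (rule exchange)
      fix c d assume cd: "(c, d) \<in> w - {(j, i), (i+1, k)}" "{c, d} \<inter> {i, i+1, j, k} = {}"
      have cw: "(c, d) \<in> w"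
        using cd(1) by (rule DiffD1)
      have ne: "c \<noteq> i" "c \<noteq> i+1" "d \<noteq> i" "d \<noteq> i+1"
        using cd(2) by auto
      have "c < i \<or> i+1 < c" "d < i \<or> i+1 < d" "c < d"
        using ne web_bounds(2)[OF w cw] by linarith+
      with nc[OF side(1) cw] nc[OF side(2) cw] side(3,4)
      show "\<not> (j < c \<and> c < k \<and> k < d) \<and> \<not> (c < j \<and> j < d \<and> d < k)"
        by (elim disjE) auto
    next
      show "{fst (j, i), snd (j, i), fst (i+1, k), snd (i+1, k)} = {i, i+1, j, k}"
        by auto
      show "1 \<le> j" "j < k" "k \<le> 2*n" "i \<noteq> j" "i \<noteq> k" "i+1 \<noteq> j" "i+1 \<noteq> k"
        using side(3,4) web_bounds[OF w side(1)] web_bounds[OF w side(2)] by simp_all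
    qed (use side(1,2) in simp_all)
  next
    case (right j k)
    show ?thesis unfolding right(5)
    proof (rule exchange)
      fix c d assume cd: "(c, d) \<in> w - {(i, j), (i+1, k)}" "{c, d} \<inter> {i, i+1, k, j} = {}"
      have cw: "(c, d) \<in> w"
        using cd(1) by (rule DiffD1)
      have ne: "c \<noteq> i" "c \<noteq> i+1" "d \<noteq> i" "d \<noteq> i+1"
        using cd(2) by auto
      have "c < i \<or> i+1 < c" "d < i \<or> i+1 < d" "c < d"
        using ne web_bounds(2)[OF w cw] by linarith+
      with nc[OF right(1) cw] nc[OF right(2) cw] right(3,4)
      show "\<not> (k < c \<and> c < j \<and> j < d) \<and> \<not> (c < k \<and> k < d \<and> d < j)"
        by (elim disjE) auto
    next
      show "{fst (i, j), snd (i, j), fst (i+1, k), snd (i+1, k)} = {i, i+1, k, j}"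
        by auto
      show "1 \<le> k" "k < j" "j \<le> 2*n" "i \<noteq> k" "i \<noteq> j" "i+1 \<noteq> k" "i+1 \<noteq> j"
        using right(3,4) web_bounds[OF w right(1)] web_bounds[OF w right(2)] by simp_all
    qed (use right(1,2) in simp_all)
  next
    case (left j k)
    show ?thesis unfolding left(5)
    proof (rule exchange)
      fix c d assume cd: "(c, d) \<in> w - {(j, i), (k, i+1)}" "{c, d} \<inter> {i, i+1, k, j} = {}"
      have cw: "(c, d) \<in> w"
        using cd(1) by (rule DiffD1)
      have ne: "c \<noteq> i" "c \<noteq> i+1" "d \<noteq> i" "d \<noteq> i+1"
        using cd(2) by auto
      have "c < i \<or> i+1 < c" "d < i \<or> i+1 < d" "c < d"
        using ne web_bounds(2)[OF w cw] by linarith+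
      with nc[OF left(1) cw] nc[OF left(2) cw] left(3,4)
      show "\<not> (k < c \<and> c < j \<and> j < d) \<and> \<not> (c < k \<and> k < d \<and> d < j)"
        by (elim disjE) auto
    next
      show "{fst (j, i), snd (j, i), fst (k, i+1), snd (k, i+1)} = {i, i+1, k, j}"
        by auto
      show "1 \<le> k" "k < j" "j \<le> 2*n" "i \<noteq> k" "i \<noteq> j" "i+1 \<noteq> k" "i+1 \<noteq> j"
        using left(3,4) web_bounds[OF w left(1)] web_bounds[OF w left(2)] by simp_all
    qed (use left(1,2) in simp_all)
  qed
qed

section \<open>Rejoining and nesting numbers\<close>

definition beneath :: "nat \<times> nat \<Rightarrow> nat \<times> nat \<Rightarrow> nat" where
  "beneath a b = of_bool (fst b < fst a \<and> fst a < snd a \<and> snd a < snd b)"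

lemma nesting_eq_sum_beneath:
  assumes "finite w"
  shows "nesting w = (\<Sum>a\<in>w. \<Sum>b\<in>w. beneath a b)"
  unfolding nesting_def nested_def beneath_def
  using assms by (intro sum.cong refl) (simp add: Int_def conj_commute)

lemma nesting_insert2:
  assumes "finite R" "p \<notin> R" "q \<notin> R" "p \<noteq> q"
  shows "nesting (insert p (insert q R)) = nesting R +
    (\<Sum>x\<in>R. beneath p x + beneath q x + beneath x p + beneath x q) + beneath p q + beneath q p"
proof -
  have "beneath a a = 0" for a by (simp add: beneath_def)
  then show ?thesis
    using assms by (simp add: nesting_eq_sum_beneath sum.distrib)
qed

text \<open>
  Trading two arcs changes only the pairs that involve them. The equation is arranged without
  subtraction, because these are natural numbers.
\<close>

lemma nesting_exchange:
  assumes w: "w \<in> webs n" and pq: "p \<in> w" "q \<in> w" "p \<noteq> q"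
    and new: "p' \<notin> w" "q' \<notin> w" "p' \<noteq> q'"
  shows "nesting (insert p' (insert q' (w - {p, q}))) + (beneath p q + beneath q p)
      + (\<Sum>x\<in>w - {p, q}. beneath p x + beneath q x + beneath x p + beneath x q) =
    nesting w + (beneath p' q' + beneath q' p')
      + (\<Sum>x\<in>w - {p, q}. beneath p' x + beneath q' x + beneath x p' + beneath x q')"
proof -
  let ?R = "w - {p, q}"
  have "finite ?R" using finite_web[OF w] by simp
  moreover have "w = insert p (insert q ?R)" using pq by auto
  ultimately show ?thesis
    using nesting_insert2[of ?R p q] nesting_insert2[of ?R p' q'] pq new by auto
qed

text \<open>
  An arc beneath \<open>(j, i)\<close> or \<open>(i+1, k)\<close> passes beneath \<open>(j, k)\<close>, and an arc above one of them lies
  above both and remains above both new arcs. So no other arc changes the count, and the extra one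
  comes from \<open>(i, i+1)\<close> lying beneath \<open>(j, k)\<close>.
\<close>

lemma nesting_rejoin_side:
  assumes w: "w \<in> webs n" and arcs: "(j, i) \<in> w" "(i+1, k) \<in> w" and lt: "j < i" "i+1 < k"
  shows "nesting (insert (i, i+1) (insert (j, k) (w - {(j, i), (i+1, k)}))) = nesting w + 1"
proof -
  let ?R = "w - {(j, i), (i+1, k)}"
  have new: "(i, i+1) \<notin> w" "(j, k) \<notin> w"
    using web_arc_disjoint[OF w arcs(1), of i "i+1"] web_arc_disjoint[OF w arcs(1), of j k] lt
    by auto
  have "beneath (i, i+1) x + beneath (j, k) x + beneath x (i, i+1) + beneath x (j, k) =
      beneath (j, i) x + beneath (i+1, k) x + beneath x (j, i) + beneath x (i+1, k)" if "x \<in> ?R" for x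
  proof -
    obtain c d where x: "x = (c, d)" by (cases x)
    then have cd: "(c, d) \<in> w" "(j, i) \<noteq> (c, d)" "(i+1, k) \<noteq> (c, d)" using that by auto
    have "c < d"
      using web_bounds(2)[OF w cd(1)] .
    \<comment> \<open>Locating both endpoints among the four points leaves finitely many positions; those that
      cross an old arc are impossible, and in each of the others both sides are numerals.\<close>
    have "c < j \<or> j < c \<and> c < i \<or> i+1 < c \<and> c < k \<or> k < c"
      using web_arc_disjoint[OF w arcs(1) cd(1,2)] web_arc_disjoint[OF w arcs(2) cd(1,3)] lt by linarith
    moreover have "d < j \<or> j < d \<and> d < i \<or> i+1 < d \<and> d < k \<or> k < d"
      using web_arc_disjoint[OF w arcs(1) cd(1,2)] web_arc_disjoint[OF w arcs(2) cd(1,3)] lt by linarith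
    moreover note web_noncrossing[OF w arcs(1) cd(1)] web_noncrossing[OF w arcs(2) cd(1)]
      web_noncrossing[OF w cd(1) arcs(1)] web_noncrossing[OF w cd(1) arcs(2)]
    ultimately show ?thesis
      using lt \<open>c < d\<close> unfolding x beneath_def by (elim disjE conjE) simp_all
  qed
  then show ?thesis
    using nesting_exchange[OF w arcs _ new] lt by (simp add: beneath_def)
qed

text \<open>
  The pair formed by \<open>(i+1, k)\<close> beneath \<open>(i, j)\<close> is lost, and so are the two relations of every arc
  beneath \<open>(i+1, k)\<close>; arcs between \<open>k\<close> and \<open>j\<close>, and arcs around all four points, count as before.
  The mirror image is the next lemma.
\<close>

lemma nesting_rejoin_right:
  assumes w: "w \<in> webs n" and arcs: "(i, j) \<in> w" "(i+1, k) \<in> w" and lt: "i+1 < k" "k < j"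
  shows "nesting (insert (i, i+1) (insert (k, j) (w - {(i, j), (i+1, k)}))) \<le> nesting w"
proof -
  let ?R = "w - {(i, j), (i+1, k)}"
  have new: "(i, i+1) \<notin> w" "(k, j) \<notin> w"
    using web_arc_disjoint[OF w arcs(1), of i "i+1"] web_arc_disjoint[OF w arcs(1), of k j] lt
    by auto
  have "beneath (i, i+1) x + beneath (k, j) x + beneath x (i, i+1) + beneath x (k, j) \<le>
      beneath (i, j) x + beneath (i+1, k) x + beneath x (i, j) + beneath x (i+1, k)" if "x \<in> ?R" for x
  proof -
    obtain c d where x: "x = (c, d)" by (cases x)
    then have cd: "(c, d) \<in> w" "(i, j) \<noteq> (c, d)" "(i+1, k) \<noteq> (c, d)" using that by auto
    have "c < d"
      using web_bounds(2)[OF w cd(1)] .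
    have "c < i \<or> i+1 < c \<and> c < k \<or> k < c \<and> c < j \<or> j < c"
      using web_arc_disjoint[OF w arcs(1) cd(1,2)] web_arc_disjoint[OF w arcs(2) cd(1,3)] lt by linarith
    moreover have "d < i \<or> i+1 < d \<and> d < k \<or> k < d \<and> d < j \<or> j < d"
      using web_arc_disjoint[OF w arcs(1) cd(1,2)] web_arc_disjoint[OF w arcs(2) cd(1,3)] lt by linarith
    moreover note web_noncrossing[OF w arcs(1) cd(1)] web_noncrossing[OF w arcs(2) cd(1)]
      web_noncrossing[OF w cd(1) arcs(1)] web_noncrossing[OF w cd(1) arcs(2)]
    ultimately show ?thesis
      using lt \<open>c < d\<close> unfolding x beneath_def by (elim disjE conjE) simp_all
  qed
  then have "(\<Sum>x\<in>?R. beneath (i, i+1) x + beneath (k, j) x + beneath x (i, i+1) + beneath x (k, j)) \<le>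
      (\<Sum>x\<in>?R. beneath (i, j) x + beneath (i+1, k) x + beneath x (i, j) + beneath x (i+1, k))"
    by (rule sum_mono)
  then show ?thesis
    using nesting_exchange[OF w arcs _ new] lt by (simp add: beneath_def)
qed

lemma nesting_rejoin_left:
  assumes w: "w \<in> webs n" and arcs: "(j, i) \<in> w" "(k, i+1) \<in> w" and lt: "k < j" "j < i"
  shows "nesting (insert (i, i+1) (insert (k, j) (w - {(j, i), (k, i+1)}))) \<le> nesting w"
proof -
  let ?R = "w - {(j, i), (k, i+1)}"
  have new: "(i, i+1) \<notin> w" "(k, j) \<notin> w"
    using web_arc_disjoint[OF w arcs(1), of i "i+1"] web_arc_disjoint[OF w arcs(1), of k j] lt
    by auto
  have "beneath (i, i+1) x + beneath (k, j) x + beneath x (i, i+1) + beneath x (k, j) \<le>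
      beneath (j, i) x + beneath (k, i+1) x + beneath x (j, i) + beneath x (k, i+1)" if "x \<in> ?R" for x
  proof -
    obtain c d where x: "x = (c, d)" by (cases x)
    then have cd: "(c, d) \<in> w" "(j, i) \<noteq> (c, d)" "(k, i+1) \<noteq> (c, d)" using that by auto
    have "c < d"
      using web_bounds(2)[OF w cd(1)] .
    have "c < k \<or> k < c \<and> c < j \<or> j < c \<and> c < i \<or> i+1 < c"
      using web_arc_disjoint[OF w arcs(1) cd(1,2)] web_arc_disjoint[OF w arcs(2) cd(1,3)] lt by linarith
    moreover have "d < k \<or> k < d \<and> d < j \<or> j < d \<and> d < i \<or> i+1 < d"
      using web_arc_disjoint[OF w arcs(1) cd(1,2)] web_arc_disjoint[OF w arcs(2) cd(1,3)] lt by linarith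
    moreover note web_noncrossing[OF w arcs(1) cd(1)] web_noncrossing[OF w arcs(2) cd(1)]
      web_noncrossing[OF w cd(1) arcs(1)] web_noncrossing[OF w cd(1) arcs(2)]
    ultimately show ?thesis
      using lt \<open>c < d\<close> unfolding x beneath_def by (elim disjE conjE) simp_all
  qed
  then have "(\<Sum>x\<in>?R. beneath (i, i+1) x + beneath (k, j) x + beneath x (i, i+1) + beneath x (k, j)) \<le>
      (\<Sum>x\<in>?R. beneath (j, i) x + beneath (k, i+1) x + beneath x (j, i) + beneath x (k, i+1))"
    by (rule sum_mono)
  then show ?thesis
    using nesting_exchange[OF w arcs _ new] lt by (simp add: beneath_def)
qed

lemma nesting_rejoin_le:
  assumes w: "w \<in> webs n" and i: "i \<in> {1..<2*n}" and no: "(i, i+1) \<notin> w"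
  shows "nesting (rejoin i w) \<le> nesting w + 1"
  using assms
proof (cases rule: rejoin_cases)
  case (side j k)
  then show ?thesis using nesting_rejoin_side[OF w] by simp
next
  case (right j k)
  then show ?thesis
    using nesting_rejoin_right[OF w] by force
next
  case (left j k)
  then show ?thesis
    using nesting_rejoin_left[OF w] by force
qed

section \<open>Linear independence of the Specht vectors\<close>

text \<open>
  Vectors with distinct leading basis elements are independent. Here \<open>l t\<close> is the leading basis
  element of \<open>v t\<close>, and \<open>m\<close> ranks the indices so that any other leading element occurring in \<open>v t\<close>
  has larger rank. In a nontrivial relation, the leading element of a vector of least rank with
  nonzero coefficient cannot be cancelled.
\<close>

lemma unitriangular_independent:
  fixes v :: "'t \<Rightarrow> ('b \<Rightarrow>\<^sub>0 complex)" and l :: "'t \<Rightarrow> 'b" and m :: "'t \<Rightarrow> nat"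
  assumes lead: "\<And>t. t \<in> S \<Longrightarrow> Poly_Mapping.lookup (v t) (l t) = 1"
    and lower: "\<And>s t. s \<in> S \<Longrightarrow> t \<in> S \<Longrightarrow> s \<noteq> t \<Longrightarrow> Poly_Mapping.lookup (v t) (l s) \<noteq> 0 \<Longrightarrow> m t < m s"
  shows "inj_on v S" and "\<not> free.vs1.dependent (v ` S)"
proof -
  show inj: "inj_on v S"
  proof (rule inj_onI, rule ccontr)
    fix s t assume st: "s \<in> S" "t \<in> S" "v s = v t" "s \<noteq> t"
    then have "m t < m s" "m s < m t"
      using lower[of s t] lower[of t s] lead[of s] lead[of t] by auto
    then show False by simp
  qed
  show "\<not> free.vs1.dependent (v ` S)"
  proof
    assume "free.vs1.dependent (v ` S)"
    then obtain U c where U: "finite U" "U \<subseteq> v ` S" "(\<Sum>x\<in>U. c x *\<^sub>c x) = 0" "\<exists>x\<in>U. c x \<noteq> 0"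
      unfolding free.vs1.dependent_explicit by blast
    obtain A where A: "A \<subseteq> S" "U = v ` A"
      using U(2) by (auto simp: subset_image_iff)
    then have injA: "inj_on v A" and "finite A"
      using inj U(1) by (auto simp: inj_on_subset finite_image_iff)
    define N where "N = {t \<in> A. c (v t) \<noteq> 0}"
    have "N \<noteq> {}" "finite N"
      using U(4) A \<open>finite A\<close> by (auto simp: N_def)
    then obtain t where t: "t \<in> N" "\<And>s. s \<in> N \<Longrightarrow> m t \<le> m s"
      by (metis arg_min_if_finite(1) arg_min_least)
    have "0 = Poly_Mapping.lookup (\<Sum>x\<in>U. c x *\<^sub>c x) (l t)"
      using U(3) by simp
    also have "\<dots> = (\<Sum>s\<in>A. c (v s) * Poly_Mapping.lookup (v s) (l t))"
      by (simp add: A(2) lookup_sum sum.reindex[OF injA])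
    also have "\<dots> = (\<Sum>s\<in>{t}. c (v s) * Poly_Mapping.lookup (v s) (l t))"
    proof (rule sum.mono_neutral_right)
      show "\<forall>s\<in>A - {t}. c (v s) * Poly_Mapping.lookup (v s) (l t) = 0"
      proof (intro ballI, rule ccontr)
        fix s assume s: "s \<in> A - {t}" "c (v s) * Poly_Mapping.lookup (v s) (l t) \<noteq> 0"
        then have "m s < m t" using t(1) A(1) by (intro lower) (auto simp: N_def)
        moreover have "s \<in> N" using s by (auto simp: N_def)
        ultimately show False using t(2) by fastforce
      qed
    qed (use t \<open>finite A\<close> in \<open>auto simp: N_def\<close>)
    also have "\<dots> = c (v t)"
      using lead[of t] t(1) A(1) by (auto simp: N_def)
    finally show False
      using t(1) by (simp add: N_def)
  qed
qed

text \<open>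
  This statistic is constant on tabloids and replaces the dominance order: column permutations of a
  standard tableau can only increase it.
\<close>

definition top_sum :: "tableau \<Rightarrow> nat" where
  "top_sum T = sum_list (fst T)"

lemma tabloid_eqD:
  assumes "tabloid S = tabloid T"
  shows "set (fst S) = set (fst T)" "set (snd S) = set (snd T)" "top_sum S = top_sum T"
proof -
  have "S \<in> tabloid T"
    using assms by (auto simp: tabloid_def)
  then have *: "mset (fst S) = mset (fst T)" "mset (snd S) = mset (snd T)"
    by (auto simp: tabloid_def)
  show "set (fst S) = set (fst T)" "set (snd S) = set (snd T)"
    using * mset_eq_setD by blast+
  show "top_sum S = top_sum T"
    using *(1) unfolding top_sum_def by (metis sum_mset_sum_list)
qed

lemma syt_eq_if_tabloid_eq:
  assumes "S \<in> syt n" "T \<in> syt n" "tabloid S = tabloid T"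
  shows "S = T"
proof (rule prod_eqI)
  show "fst S = fst T" "snd S = snd T"
    using tabloid_eqD[OF assms(3)] assms(1,2) by (auto simp: syt_def intro!: strict_sorted_equal)
qed

lemma id_in_Col: "id \<in> Col n T"
  by (auto simp: Col_def permutes_id)

lemma finite_Col: "finite (Col n T)"
  by (rule finite_subset[OF _ finite_permutations[of "{1..2*n}"]]) (auto simp: Col_def)

text \<open>
  A column permutation replaces top entries by the larger entries below them, and a column
  permutation that moves no top entry is the identity.
\<close>

lemma top_sum_column_less:
  assumes T: "T \<in> syt n" and \<sigma>: "\<sigma> \<in> Col n T" "\<sigma> \<noteq> id"
  shows "top_sum T < top_sum (perm_tableau \<sigma> T)"
proof -
  have len: "length (fst T) = n" "length (snd T) = n" and S: "set (fst T) \<union> set (snd T) = {1..2*n}"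
    using T by (auto simp: syt_def tableau_def)
  have lt: "fst T ! j < snd T ! j" if "j < n" for j
    using T that by (auto simp: syt_def)
  have \<sigma>': "\<sigma> permutes {1..2*n}" "\<And>j. j < n \<Longrightarrow> \<sigma> ` {fst T ! j, snd T ! j} = {fst T ! j, snd T ! j}"
    using \<sigma>(1) by (auto simp: Col_def)
  have ge: "fst T ! j \<le> \<sigma> (fst T ! j)" if "j < n" for j
  proof -
    have "\<sigma> (fst T ! j) \<in> {fst T ! j, snd T ! j}"
      using \<sigma>'(2)[OF that] by blast
    then show ?thesis using lt[OF that] by auto
  qed
  have "\<exists>j<n. \<sigma> (fst T ! j) \<noteq> fst T ! j"
  proof (rule ccontr)
    assume "\<not> ?thesis"
    then have fix_top: "\<sigma> (fst T ! j) = fst T ! j" if "j < n" for j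
      using that by blast
    have "\<sigma> (snd T ! j) = snd T ! j" if "j < n" for j
    proof -
      have "inj \<sigma>" using \<sigma>'(1) by (rule permutes_inj)
      then have "\<sigma> (snd T ! j) \<noteq> \<sigma> (fst T ! j)"
        using lt[OF that] by (metis inj_eq less_irrefl_nat)
      then show ?thesis
        using \<sigma>'(2)[OF that] fix_top[OF that] by auto
    qed
    then have "\<sigma> x = x" if "x \<in> {1..2*n}" for x
      using that fix_top len unfolding S[symmetric] by (auto simp: in_set_conv_nth)
    then have "\<sigma> = id"
      using permutes_not_in[OF \<sigma>'(1)] by (intro ext) (metis id_apply)
    then show False using \<sigma>(2) by simp
  qed
  then obtain j where j: "j < n" "\<sigma> (fst T ! j) \<noteq> fst T ! j"
    by blast
  have "(\<Sum>j<n. fst T ! j) < (\<Sum>j<n. \<sigma> (fst T ! j))"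
  proof (rule sum_strict_mono_ex1)
    show "\<exists>j\<in>{..<n}. fst T ! j < \<sigma> (fst T ! j)"
      using j ge[of j] by (intro bexI[of _ j]) auto
  qed (use ge in auto)
  then show ?thesis
    by (simp add: top_sum_def perm_tableau_def sum_list_sum_nth len atLeast0LessThan)
qed

lemma lookup_specht:
  "Poly_Mapping.lookup (specht n T) X = (\<Sum>\<sigma>\<in>Col n T. of_int (sign \<sigma>) * (1 when tabloid (perm_tableau \<sigma> T) = X))"
  by (simp add: specht_def lookup_sum lookup_single)

lemma specht_basis:
  shows "inj_on (specht n) (syt n)" and "\<not> free.vs1.dependent (specht n ` syt n)"
proof -
  have lead: "Poly_Mapping.lookup (specht n T) (tabloid T) = 1" if T: "T \<in> syt n" for T
  proof -
    have "tabloid (perm_tableau \<sigma> T) \<noteq> tabloid T" if "\<sigma> \<in> Col n T - {id}" for \<sigma>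
      using top_sum_column_less[OF T, of \<sigma>] tabloid_eqD(3)[of "perm_tableau \<sigma> T" T] that by auto
    then have "Poly_Mapping.lookup (specht n T) (tabloid T) =
        (\<Sum>\<sigma>\<in>{id}. of_int (sign \<sigma>) * (1 when tabloid (perm_tableau \<sigma> T) = tabloid T))"
      unfolding lookup_specht
      by (intro sum.mono_neutral_right) (auto simp: finite_Col id_in_Col)
    then show ?thesis
      by (simp add: perm_tableau_def)
  qed
  have lower: "top_sum T < top_sum S"
    if "S \<in> syt n" "T \<in> syt n" "S \<noteq> T" and nz: "Poly_Mapping.lookup (specht n T) (tabloid S) \<noteq> 0" for S T
  proof -
    obtain \<sigma> where \<sigma>: "\<sigma> \<in> Col n T" "tabloid (perm_tableau \<sigma> T) = tabloid S"
      using nz unfolding lookup_specht by (auto elim!: sum.not_neutral_contains_not_neutral simp: when_def split: if_splits)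
    have "\<sigma> \<noteq> id"
      using \<sigma>(2) syt_eq_if_tabloid_eq[OF that(1,2)] that(3) by (auto simp: perm_tableau_def)
    then show ?thesis
      using top_sum_column_less[OF that(2) \<sigma>(1)] tabloid_eqD(3)[OF \<sigma>(2)] by simp
  qed
  show "inj_on (specht n) (syt n)"
    by (rule unitriangular_independent(1)[of "syt n" "specht n" tabloid top_sum, OF lead lower])
  show "\<not> free.vs1.dependent (specht n ` syt n)"
    by (rule unitriangular_independent(2)[of "syt n" "specht n" tabloid top_sum, OF lead lower])
qed

lemma phi_specht:
  assumes "T \<in> syt n"
  shows "phi n (specht n T) = phi_val n T"
proof -
  have "specht n T \<in> specht n ` syt n" using assms by (rule imageI)
  then have "phi n (specht n T) = phi_val n (inv_into (syt n) (specht n) (specht n T))"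
    unfolding phi_def by (rule free.construct_basis[OF specht_basis(2)])
  also have "inv_into (syt n) (specht n) (specht n T) = T"
    using specht_basis(1) assms by (rule inv_into_f_f)
  finally show ?thesis .
qed

section \<open>Paths in the tableau graph\<close>

lemma perm_tableau_involution:
  "perm_tableau (transpose i k) (perm_tableau (transpose i k) T) = T"
  by (simp add: perm_tableau_def)

lemma transpose_descent_in_syt:
  assumes T: "T \<in> syt n" and i: "i \<in> set (fst T)" "i+1 \<in> set (snd T)"
    and col: "\<forall>j<n. fst T ! j = i \<longrightarrow> snd T ! j \<noteq> i+1"
  shows "perm_tableau (transpose i (i+1)) T \<in> syt n"
proof -
  let ?t = "transpose i (i+1)"
  have len: "length (fst T) = n" "length (snd T) = n" and
    dist: "distinct (fst T @ snd T)" and S: "set (fst T @ snd T) = {1..2*n}" and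
    srt: "sorted_wrt (<) (fst T)" "sorted_wrt (<) (snd T)" and
    lt: "\<And>j. j < n \<Longrightarrow> fst T ! j < snd T ! j"
    using T by (auto simp: syt_def tableau_def)
  have no: "i+1 \<notin> set (fst T)" "i \<notin> set (snd T)"
    using i dist by auto
  have top: "?t x = (if x = i then i+1 else x)" if "x \<in> set (fst T)" for x
    using that no by (auto simp: transpose_def)
  have bot: "?t x = (if x = i+1 then i else x)" if "x \<in> set (snd T)" for x
    using that no by (auto simp: transpose_def)
  have "i \<in> {1..2*n}" "i+1 \<in> {1..2*n}"
    using i unfolding S[symmetric] by auto
  then have "?t ` {1..2*n} = {1..2*n}"
    by (rule permutes_image[OF permutes_swap_id])
  moreover have "distinct (map ?t (fst T @ snd T))"
    using dist by (simp only: distinct_map inj_on_subset[OF inj_transpose subset_UNIV] simp_thms)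
  ultimately have "tableau n (perm_tableau ?t T)"
    using len S by (simp add: tableau_def perm_tableau_def flip: image_Un)
  moreover have "sorted_wrt (<) (map ?t (fst T))"
    unfolding sorted_wrt_map
  proof (rule sorted_wrt_mono_rel[OF _ srt(1)])
    fix x y assume "x \<in> set (fst T)" "y \<in> set (fst T)" "x < y"
    then show "?t x < ?t y"
      using no(1) top[of x] top[of y] by (cases "y = i + 1") auto
  qed
  moreover have "sorted_wrt (<) (map ?t (snd T))"
    unfolding sorted_wrt_map
  proof (rule sorted_wrt_mono_rel[OF _ srt(2)])
    fix x y assume "x \<in> set (snd T)" "y \<in> set (snd T)" "x < y"
    then show "?t x < ?t y"
      using no(2) bot[of x] bot[of y] by (cases "x = i") auto
  qed
  moreover have "?t (fst T ! j) < ?t (snd T ! j)" if "j < n" for j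
  proof -
    have "fst T ! j \<in> set (fst T)" "snd T ! j \<in> set (snd T)"
      using that len by auto
    then show ?thesis
      using lt[OF that] col that no top[of "fst T ! j"] bot[of "snd T ! j"]
      by (cases "fst T ! j = i"; cases "snd T ! j = i+1"; cases "snd T ! j = i") auto
  qed
  ultimately show ?thesis
    using len by (simp add: syt_def perm_tableau_def)
qed

text \<open>
  If there is no such \<open>i\<close>, then whenever the predecessor of a bottom entry is a top entry, it is the
  one directly above. In that case the columns are forced from left to right: if the first \<open>j\<close> of them hold \<open>1, \<dots>, 2j\<close>, the next
  top entry is \<open>2j+1\<close>, and the predecessor of the next bottom entry is neither in an earlier column
  nor a later bottom entry, so that bottom entry is \<open>2j+2\<close>.
\<close>

lemma exists_descent:
  assumes T: "T \<in> syt n" and "T \<noteq> T0 n"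
  obtains i where "i \<in> set (fst T)" "i+1 \<in> set (snd T)"
    "\<forall>j<n. fst T ! j = i \<longrightarrow> snd T ! j \<noteq> i+1"
proof -
  have len: "length (fst T) = n" "length (snd T) = n" and
    dist: "distinct (fst T)" "distinct (snd T)" "set (fst T) \<inter> set (snd T) = {}" and
    S: "set (fst T) \<union> set (snd T) = {1..2*n}" and
    srt: "sorted_wrt (<) (fst T)" "sorted_wrt (<) (snd T)" and
    lt: "\<And>j. j < n \<Longrightarrow> fst T ! j < snd T ! j"
    using T by (auto simp: syt_def tableau_def)
  have "\<exists>j<n. \<exists>a\<in>set (fst T). snd T ! j = a + 1 \<and> a \<noteq> fst T ! j"
  proof (rule ccontr)
    assume "\<not> ?thesis"
    then have tight: "a = fst T ! j" if "j < n" "a \<in> set (fst T)" "snd T ! j = a + 1" for a j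
      using that by blast
    have "fst T ! j = 2*j+1 \<and> snd T ! j = 2*j+2" if "j < n" for j
      using that
    proof (induction j rule: less_induct)
      case (less j)
      have IH: "fst T ! k = 2*k+1" "snd T ! k = 2*k+2" if "k < j" for k
        using less that by auto
      have mem: "fst T ! j \<in> set (fst T)" "snd T ! j \<in> set (snd T)"
        using less.prems len by auto
      have top_mono: "fst T ! j \<le> fst T ! k" if "j \<le> k" "k < n" for k
        using sorted_wrt_nth_less[OF srt(1), of j k] that len by (cases "j = k") auto
      have "fst T ! j \<ge> 2*j+1"
      proof (rule ccontr)
        assume "\<not> ?thesis"
        moreover have "1 \<le> fst T ! j" using mem(1) S by auto
        ultimately have "(fst T ! j - 1) div 2 < j" by linarith
        moreover define k where "k = (fst T ! j - 1) div 2"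
        moreover have "fst T ! j = 2*k+1 \<or> fst T ! j = 2*k+2"
          using \<open>1 \<le> fst T ! j\<close> unfolding k_def by presburger
        ultimately have k: "k < j" "fst T ! j = fst T ! k \<or> fst T ! j = snd T ! k"
          using IH[of k] by auto
        then have "fst T ! k < fst T ! j" "snd T ! k \<in> set (snd T)"
          using sorted_wrt_nth_less[OF srt(1) k(1)] less.prems len by auto
        then show False using k(2) mem dist(3) by auto
      qed
      moreover have "fst T ! j \<le> 2*j+1"
      proof -
        have "2*j+1 \<in> set (fst T) \<union> set (snd T)"
          using less.prems unfolding S by auto
        then obtain k where k: "k < n" "2*j+1 = fst T ! k \<or> 2*j+1 = snd T ! k"
          using len by (auto simp: in_set_conv_nth)
        then have "j \<le> k"
          using IH[of k] by (cases "k < j") auto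
        then show ?thesis
          using k top_mono[of k] lt[of k] by auto
      qed
      ultimately have top: "fst T ! j = 2*j+1" by simp
      have "snd T ! j - 1 \<in> {1..2*n}"
      proof -
        have "snd T ! j \<in> {1..2*n}" using mem(2) unfolding S[symmetric] by (rule UnI2)
        then show ?thesis using lt[OF less.prems] top by (simp; linarith)
      qed
      then have "snd T ! j - 1 \<in> set (fst T) \<or> snd T ! j - 1 \<in> set (snd T)"
        using S by auto
      moreover have False if bottom: "snd T ! j - 1 \<in> set (snd T)"
      proof -
        obtain k where k: "k < n" "snd T ! j - 1 = snd T ! k"
          using bottom len by (auto simp: in_set_conv_nth)
        then have "k < j"
          using sorted_wrt_nth_less[OF srt(2), of j k] len lt[OF less.prems]
          by (cases "k < j"; cases "k = j") auto
        then show False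
          using IH(2)[of k] k(2) lt[OF less.prems] top by auto
      qed
      ultimately have "snd T ! j - 1 = fst T ! j"
        using tight[of j "snd T ! j - 1"] less.prems lt[of j] by auto
      then show ?case
        using top lt[OF less.prems] by auto
    qed
    then have "T = T0 n"
      using len by (auto simp: T0_def intro!: prod_eqI nth_equalityI)
    then show False using assms(2) by simp
  qed
  then obtain j a where ja: "j < n" "a \<in> set (fst T)" "snd T ! j = a + 1" "a \<noteq> fst T ! j"
    by blast
  show thesis
  proof (rule that[of a])
    show "a + 1 \<in> set (snd T)"
      using ja len by (metis nth_mem)
    show "\<forall>k<n. fst T ! k = a \<longrightarrow> snd T ! k \<noteq> a + 1"
      using ja dist(2) len by (metis nth_eq_iff_index_eq)
  qed (rule ja)
qed

text \<open>
  Walking backwards from \<open>T\<close>: each step moves \<open>i+1\<close> out of the bottom row in exchange for \<open>i\<close>, so the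
  sum of the bottom row decreases until \<^term>\<open>T0 n\<close> is reached.
\<close>

lemma tableau_path_exists:
  assumes "T \<in> syt n"
  shows "\<exists>ls. tableau_path n (T0 n) ls T"
  using assms
proof (induction "\<Sum>(set (snd T))" arbitrary: T rule: less_induct)
  case less
  show ?case
  proof (cases "T = T0 n")
    case True
    then show ?thesis
      using less.prems tableau_path.intros(1) by blast
  next
    case False
    obtain i where i: "i \<in> set (fst T)" "i+1 \<in> set (snd T)"
      and col: "\<forall>j<n. fst T ! j = i \<longrightarrow> snd T ! j \<noteq> i+1"
      by (rule exists_descent[OF less.prems False])
    let ?t = "transpose i (i+1)" and ?T = "perm_tableau (transpose i (i+1)) T"
    have T': "?T \<in> syt n"
      by (rule transpose_descent_in_syt[OF less.prems i col])
    have S: "set (fst T) \<inter> set (snd T) = {}" "set (fst T) \<union> set (snd T) = {1..2*n}"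
      using less.prems by (auto simp: syt_def tableau_def)
    have "i \<notin> set (snd T)" using i S by auto
    then have "?t ` set (snd T) = insert i (set (snd T) - {i+1})"
      using i(2) by (auto simp: transpose_def image_iff)
    then have "\<Sum>(set (snd ?T)) = i + \<Sum>(set (snd T) - {i+1})"
      using \<open>i \<notin> set (snd T)\<close> by (simp add: perm_tableau_def)
    also have "\<dots> < \<Sum>(set (snd T))"
      using i(2) by (simp add: sum.remove[of _ "i+1"])
    finally obtain ls where "tableau_path n (T0 n) ls ?T"
      using less.hyps T' by blast
    moreover have "tableau_edge n i ?T T"
    proof -
      have "i \<in> {1..2*n}" "i+1 \<in> {1..2*n}" using i S by blast+
      moreover have "i+1 \<in> ?t ` set (fst T)" "i \<in> ?t ` set (snd T)"
        using i by (metis imageI transpose_apply_first, metis imageI transpose_apply_second)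
      ultimately show ?thesis
        using T' less.prems
        by (simp add: tableau_edge_def perm_tableau_involution) (simp add: perm_tableau_def)
    qed
    ultimately show ?thesis
      using tableau_path.intros(2) by blast
  qed
qed

section \<open>The bijection along edges\<close>

text \<open>
  When \<^const>\<open>psi\<close> reaches the right endpoint \<open>b\<close> of an arc \<open>(a, b)\<close> of \<open>w\<close>, it has produced the arcs
  of \<open>w\<close> that end before \<open>b\<close>. The point \<open>a\<close> is still free, and a point strictly between \<open>a\<close> and \<open>b\<close> is
  not, because by noncrossing its arc ends before \<open>b\<close>. So the nearest free point is \<open>a\<close>.
\<close>

lemma psi_eqI:
  assumes w: "w \<in> webs n" and srt: "sorted_wrt (<) (snd T)" and ends: "set (snd T) = snd ` w"
  shows "psi T = w"
proof -
  define step where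
    "step b w = insert (Max {a. 1 \<le> a \<and> a < b \<and> a \<notin> fst ` w \<union> snd ` w}, b) w" for b :: nat and w :: web
  have "fold step bs {} = {p \<in> w. snd p \<in> set bs}"
    if "sorted_wrt (<) bs" "set bs \<subseteq> snd ` w" "\<And>b c. b \<in> set bs \<Longrightarrow> c \<in> snd ` w \<Longrightarrow> c < b \<Longrightarrow> c \<in> set bs" for bs
    using that
  proof (induction bs rule: rev_induct)
    case Nil
    then show ?case by simp
  next
    case (snoc b bs)
    have below: "x < b" if "x \<in> set bs" for x
      using snoc.prems(1) that by (simp add: sorted_wrt_append)
    have earlier: "c \<in> set bs" if "c \<in> snd ` w" "c < b" for c
      using snoc.prems(3)[of b c] that by auto
    let ?v = "{p \<in> w. snd p \<in> set bs}"
    have IH: "fold step bs {} = ?v"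
    proof (rule snoc.IH)
      show "sorted_wrt (<) bs" "set bs \<subseteq> snd ` w"
        using snoc.prems(1,2) by (auto simp: sorted_wrt_append)
      show "c \<in> set bs" if "x \<in> set bs" "c \<in> snd ` w" "c < x" for x c
        using earlier[OF that(2)] below[OF that(1)] that(3) by simp
    qed
    obtain a where ab: "(a, b) \<in> w"
      using snoc.prems(2) by auto
    have nearest: "Max {x. 1 \<le> x \<and> x < b \<and> x \<notin> fst ` ?v \<union> snd ` ?v} = a"
    proof (rule Max_eqI)
      show "finite {x. 1 \<le> x \<and> x < b \<and> x \<notin> fst ` ?v \<union> snd ` ?v}"
        by (rule finite_subset[of _ "{..<b}"]) auto
      have "a \<noteq> fst p \<and> a \<noteq> snd p" if "p \<in> ?v" for p
      proof -
        have "p \<in> w" "snd p < b" using that below by auto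
        then have "p \<noteq> (a, b)" by auto
        then show ?thesis
          using web_unique[OF w ab \<open>p \<in> w\<close>, of a] by auto
      qed
      then show "a \<in> {x. 1 \<le> x \<and> x < b \<and> x \<notin> fst ` ?v \<union> snd ` ?v}"
        using web_bounds[OF w ab] by auto
    next
      fix x assume "x \<in> {x. 1 \<le> x \<and> x < b \<and> x \<notin> fst ` ?v \<union> snd ` ?v}"
      then have x: "1 \<le> x" "x < b" "x \<notin> fst ` ?v" "x \<notin> snd ` ?v"
        by auto
      show "x \<le> a"
      proof (rule ccontr)
        assume "\<not> x \<le> a"
        obtain p where p: "p \<in> w" "x = fst p \<or> x = snd p"
          using web_covers[OF w, of x] x web_bounds(3)[OF w ab] by auto
        obtain c d where cd: "p = (c, d)" by (cases p)
        have "d \<noteq> b"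
        proof
          assume "d = b"
          then have "p = (a, b)"
            using web_unique[OF w p(1) ab, of b] cd by simp
          then show False using p(2) x \<open>\<not> x \<le> a\<close> by auto
        qed
        moreover have "\<not> b < d"
          using web_noncrossing[OF w ab, of c d] p cd x \<open>\<not> x \<le> a\<close> by auto
        ultimately have "d \<in> set bs"
          using earlier[of d] p(1) cd by force
        then have "p \<in> ?v" using p(1) cd by simp
        then show False using x(3,4) p(2) by blast
      qed
    qed
    have "{p \<in> w. snd p \<in> set (bs @ [b])} = insert (a, b) ?v"
    proof -
      have "p \<in> w \<and> snd p = b \<longleftrightarrow> p = (a, b)" for p
        using web_unique[OF w _ ab, of p b] ab by auto
      then have "{p \<in> w. snd p = b} = {(a, b)}"
        by simp
      moreover have "{p \<in> w. snd p \<in> set (bs @ [b])} = {p \<in> w. snd p = b} \<union> ?v"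
        unfolding set_append by (intro equalityI subsetI) auto
      ultimately show ?thesis by simp
    qed
    moreover have "step b ?v = insert (a, b) ?v"
      unfolding step_def nearest ..
    ultimately show ?case
      using IH by simp
  qed
  from this[OF srt] ends have "fold step (snd T) {} = {p \<in> w. snd p \<in> snd ` w}"
    by simp
  also have "\<dots> = w"
    by auto
  finally show ?thesis
    by (simp only: psi_def step_def[abs_def])
qed

lemma w0_in_webs: "w0 n \<in> webs n"
proof -
  have bounds: "\<forall>(i,j)\<in>w0 n. 1 \<le> i \<and> i < j \<and> j \<le> 2*n"
    by (auto simp: w0_def)
  have cover: "\<exists>!a. a \<in> w0 n \<and> (k = fst a \<or> k = snd a)" if k: "k \<in> {1..2*n}" for k
  proof (rule ex1I)
    let ?m = "(k - 1) div 2"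
    have "?m < n" "k = 2 * ?m + 1 \<or> k = 2 * ?m + 2"
      using k by (simp, presburger)+
    then show "(2 * ?m + 1, 2 * ?m + 2) \<in> w0 n \<and> (k = fst (2 * ?m + 1, 2 * ?m + 2) \<or> k = snd (2 * ?m + 1, 2 * ?m + 2))"
      by (auto simp: w0_def)
    fix a assume "a \<in> w0 n \<and> (k = fst a \<or> k = snd a)"
    then show "a = (2 * ?m + 1, 2 * ?m + 2)"
      by (auto simp: w0_def)
  qed
  have "\<forall>(i,j)\<in>w0 n. \<forall>(k,l)\<in>w0 n. \<not> (i < k \<and> k < j \<and> j < l)"
    by (auto simp: w0_def)
  moreover from cover have "\<forall>k\<in>{1..2*n}. \<exists>!a. a \<in> w0 n \<and> (k = fst a \<or> k = snd a)"
    by (rule ballI)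
  ultimately show ?thesis
    using bounds unfolding webs_def mem_Collect_eq by (intro conjI)
qed

lemma T0_in_syt: "T0 n \<in> syt n"
proof -
  have "set (fst (T0 n) @ snd (T0 n)) = {1..2*n}"
  proof (intro equalityI subsetI)
    fix k assume k: "k \<in> {1..2*n}"
    let ?m = "(k - 1) div 2"
    have "?m < n" "k = 2 * ?m + 1 \<or> k = 2 * ?m + 2"
      using k by (simp, presburger)+
    then show "k \<in> set (fst (T0 n) @ snd (T0 n))"
      by (auto simp: T0_def)
  qed (auto simp: T0_def)
  moreover have "distinct (fst (T0 n) @ snd (T0 n))"
    by (auto simp: T0_def distinct_map inj_on_def) presburger
  ultimately show ?thesis
    by (simp add: syt_def tableau_def T0_def sorted_wrt_map)
qed

lemma psi_T0: "psi (T0 n) = w0 n"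
  by (rule psi_eqI[OF w0_in_webs])
    (use T0_in_syt[of n] in \<open>auto simp: syt_def\<close>, auto simp: T0_def w0_def image_iff)

text \<open>
  In \<open>T\<close> the entry \<open>i\<close> is at the bottom and \<open>i+1\<close> at the top, so the web has arcs \<open>(j, i)\<close> and
  \<open>(i+1, k)\<close>. Rejoining them makes \<open>i+1\<close> a right endpoint in place of \<open>i\<close>, which is what the edge does
  to the bottom row; right endpoints determine the web.
\<close>

lemma psi_tableau_edge:
  assumes e: "tableau_edge n i T T'" and w: "psi T \<in> webs n" and ends: "snd ` psi T = set (snd T)"
  shows "(i, i+1) \<notin> psi T" "psi T' = rejoin i (psi T)" "psi T' \<in> webs n" "snd ` psi T' = set (snd T')"
    "nesting (psi T') = nesting (psi T) + 1"
proof -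
  have syt: "T \<in> syt n" "T' \<in> syt n" and i: "i \<in> {1..<2*n}"
    and T': "T' = perm_tableau (transpose i (i+1)) T" and pos: "i \<in> set (snd T)" "i+1 \<in> set (fst T)"
    using e by (auto simp: tableau_edge_def)
  have not_bot: "i+1 \<notin> set (snd T)"
    using syt(1) pos(2) by (auto simp: syt_def tableau_def)
  obtain j where ji: "(j, i) \<in> psi T"
    using pos(1) ends by force
  obtain p where p: "p \<in> psi T" "i+1 = fst p \<or> i+1 = snd p"
    using web_covers[OF w, of "i+1"] i by auto
  moreover have "i+1 \<noteq> snd p"
    using not_bot p(1) ends by force
  ultimately obtain k where ik: "(i+1, k) \<in> psi T"
    by (cases p) auto
  have lt: "j < i" "i+1 < k"
    using web_bounds(2)[OF w ji] web_bounds(2)[OF w ik] .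
  show no: "(i, i+1) \<notin> psi T"
    using not_bot ends by force
  have eq: "rejoin i (psi T) = insert (i, i+1) (insert (j, k) (psi T - {(j, i), (i+1, k)}))"
    using rejoin_eq[OF w, of i j k] ji ik lt by (simp add: arc_def min_def max_def)
  have rw: "rejoin i (psi T) \<in> webs n"
    by (rule rejoin_in_webs[OF w i no])
  have "inj_on snd (psi T)"
    by (rule inj_onI) (use web_unique[OF w] in blast)
  then have "snd ` (psi T - {(j, i), (i+1, k)}) = snd ` psi T - {i, k}"
    using ji ik by (subst inj_on_image_set_diff[of snd "psi T"]) auto
  moreover have "k \<in> set (snd T)"
    using ik ends by force
  ultimately have "snd ` rejoin i (psi T) = insert (i+1) (set (snd T) - {i})"
    unfolding eq using lt ends by auto
  also have "\<dots> = set (snd T')"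
    using pos(1) not_bot by (auto simp: T' perm_tableau_def transpose_def image_iff)
  finally have r: "snd ` rejoin i (psi T) = set (snd T')" .
  show psi: "psi T' = rejoin i (psi T)"
    by (rule psi_eqI[OF rw]) (use syt(2) r in \<open>auto simp: syt_def\<close>)
  show "psi T' \<in> webs n" "snd ` psi T' = set (snd T')"
    using rw r by (simp_all add: psi)
  show "nesting (psi T') = nesting (psi T) + 1"
    unfolding psi eq by (rule nesting_rejoin_side[OF w ji ik lt])
qed

section \<open>The leading term along a path\<close>

lemma lookup_s_act:
  "Poly_Mapping.lookup (s_act i x) u =
    (\<Sum>v\<in>Poly_Mapping.keys x. Poly_Mapping.lookup x v * Poly_Mapping.lookup (s_web i v) u)"
  by (simp add: s_act_def lookup_sum)

lemma s_web_support:
  assumes "Poly_Mapping.lookup (s_web i v) u \<noteq> 0"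
  shows "u = v \<or> (i, i+1) \<notin> v \<and> u = rejoin i v"
  using assms by (auto simp: s_web_def lookup_add lookup_single when_def split: if_splits)

definition leading :: "nat \<Rightarrow> web \<Rightarrow> (web \<Rightarrow>\<^sub>0 complex) \<Rightarrow> bool" where
  "leading n w x \<longleftrightarrow> Poly_Mapping.lookup x w = 1 \<and>
    (\<forall>u \<in> Poly_Mapping.keys x. u \<in> webs n \<and> (u = w \<or> nesting u < nesting w))"

text \<open>
  Terms other than \<open>w\<close> have nesting number below that of \<open>w\<close>; as \<open>s\<^sub>i\<close> raises it by at most one, none of
  them reaches \<open>rejoin i w\<close>, which therefore arises from \<open>w\<close> alone.
\<close>

lemma leading_s_act:
  assumes x: "leading n w x" and w: "w \<in> webs n" and i: "i \<in> {1..<2*n}"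
    and no: "(i, i+1) \<notin> w" and up: "nesting (rejoin i w) = nesting w + 1"
  shows "leading n (rejoin i w) (s_act i x)"
proof -
  let ?w = "rejoin i w" and ?K = "Poly_Mapping.keys x"
  have one: "Poly_Mapping.lookup x w = 1"
    and K: "\<And>v. v \<in> ?K \<Longrightarrow> v \<in> webs n" "\<And>v. v \<in> ?K \<Longrightarrow> v = w \<or> nesting v < nesting w"
    using x by (auto simp: leading_def)
  \<comment> \<open>Every term of the image other than the one that arises from \<open>w\<close> by rejoining is small.\<close>
  have supp: "u \<in> webs n \<and> (nesting u \<le> nesting w \<or> v = w \<and> u = ?w)"
    if "v \<in> ?K" "Poly_Mapping.lookup (s_web i v) u \<noteq> 0" for u v
    using s_web_support[OF that(2)]
  proof (elim disjE conjE)
    assume "u = v"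
    then show ?thesis using K[OF that(1)] by auto
  next
    assume u: "(i, i+1) \<notin> v" "u = rejoin i v"
    then show ?thesis
      using rejoin_in_webs[OF K(1)[OF that(1)] i u(1)] nesting_rejoin_le[OF K(1)[OF that(1)] i u(1)]
        K(2)[OF that(1)] by auto
  qed
  have "Poly_Mapping.lookup (s_act i x) ?w =
      (\<Sum>v\<in>{w}. Poly_Mapping.lookup x v * Poly_Mapping.lookup (s_web i v) ?w)"
    unfolding lookup_s_act
  proof (rule sum.mono_neutral_right)
    show "{w} \<subseteq> ?K" using one by (simp add: in_keys_iff)
    show "\<forall>v\<in>?K - {w}. Poly_Mapping.lookup x v * Poly_Mapping.lookup (s_web i v) ?w = 0"
      using supp[of _ ?w] up by force
  qed simp
  moreover have "w \<noteq> ?w" using up by auto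
  ultimately have "Poly_Mapping.lookup (s_act i x) ?w = 1"
    using one no by (simp add: s_web_def lookup_add lookup_single)
  moreover have "u \<in> webs n \<and> (u = ?w \<or> nesting u < nesting ?w)" if u: "u \<in> Poly_Mapping.keys (s_act i x)" for u
  proof -
    obtain v where "v \<in> ?K" "Poly_Mapping.lookup (s_web i v) u \<noteq> 0"
      using u unfolding in_keys_iff lookup_s_act by (auto elim!: sum.not_neutral_contains_not_neutral)
    then show ?thesis
      using supp[of v u] up by auto
  qed
  ultimately show ?thesis
    by (simp add: leading_def)
qed

lemma leading_word_act:
  assumes "tableau_path n (T0 n) ls T"
  shows "psi T \<in> webs n \<and> snd ` psi T = set (snd T) \<and> leading n (psi T) (word_act ls (basis_vec (w0 n)))"
  using assms
proof induction
  case 1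
  have "snd ` w0 n = set (snd (T0 n))"
    by (auto simp: w0_def T0_def image_iff)
  then show ?case
    by (simp add: psi_T0 w0_in_webs leading_def word_act_def)
next
  case (2 ls T i T')
  then have w: "psi T \<in> webs n" and ends: "snd ` psi T = set (snd T)" by auto
  have i: "i \<in> {1..<2*n}"
    using 2(2) by (simp add: tableau_edge_def)
  note edge = psi_tableau_edge[OF 2(2) w ends]
  have "leading n (rejoin i (psi T)) (s_act i (word_act ls (basis_vec (w0 n))))"
    by (rule leading_s_act[OF _ w i edge(1)]) (use 2 edge in auto)
  then show ?case
    using edge by (simp add: word_act_def)
qed

theorem theorem5p5:
  fixes n :: nat and r :: "(web \<times> web) set"
  assumes "n \<ge> 1"
    and "linear_order_on (webs n) r"
    and "\<And>w w'. w \<in> webs n \<Longrightarrow> w' \<in> webs n \<Longrightarrow> web_le n w w' \<Longrightarrow> (w, w') \<in> r"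
    and "\<And>w w'. w \<in> webs n \<Longrightarrow> w' \<in> webs n \<Longrightarrow> nesting w < nesting w' \<Longrightarrow> (w, w') \<in> r"
  shows "\<forall>T' \<in> syt n. let c = Poly_Mapping.lookup (phi n (specht n T')); w' = psi T' in
    phi n (specht n T') = (\<Sum>w\<in>webs n. c w *\<^sub>c basis_vec w) \<and>
    c w' = 1 \<and>
    (\<forall>w \<in> webs n. (w, w') \<notin> r \<longrightarrow> c w = 0)"
proof
  fix T assume T: "T \<in> syt n"
  let ?x = "phi n (specht n T)"
  define ls where "ls = (SOME ls. tableau_path n (T0 n) ls T)"
  have "tableau_path n (T0 n) ls T"
    unfolding ls_def using tableau_path_exists[OF T] by (rule someI_ex)
  from leading_word_act[OF this] have w: "psi T \<in> webs n" and lead: "leading n (psi T) ?x"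
    by (simp_all add: phi_specht[OF T] phi_val_def ls_def)
  have refl: "(psi T, psi T) \<in> r"
    using assms(2) w by (auto simp: order_on_defs refl_on_def)
  have "Poly_Mapping.lookup ?x u = Poly_Mapping.lookup (\<Sum>w\<in>webs n. Poly_Mapping.lookup ?x w *\<^sub>c basis_vec w) u" for u
  proof -
    have "Poly_Mapping.lookup (\<Sum>w\<in>webs n. Poly_Mapping.lookup ?x w *\<^sub>c basis_vec w) u =
        (\<Sum>w\<in>webs n. if w = u then Poly_Mapping.lookup ?x w else 0)"
      by (simp add: lookup_sum lookup_single when_def if_distrib cong: if_cong)
    also have "\<dots> = (if u \<in> webs n then Poly_Mapping.lookup ?x u else 0)"
      by (simp add: finite_webs)
    also have "\<dots> = Poly_Mapping.lookup ?x u"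
      using lead by (auto simp: leading_def in_keys_iff)
    finally show ?thesis ..
  qed
  then have "?x = (\<Sum>w\<in>webs n. Poly_Mapping.lookup ?x w *\<^sub>c basis_vec w)"
    by (rule poly_mapping_eqI)
  moreover have "Poly_Mapping.lookup ?x w = 0" if "w \<in> webs n" "(w, psi T) \<notin> r" for w
  proof (rule ccontr)
    assume "Poly_Mapping.lookup ?x w \<noteq> 0"
    then have "w = psi T \<or> nesting w < nesting (psi T)"
      using lead by (auto simp: leading_def in_keys_iff)
    then show False
      using that refl assms(4)[OF that(1) w] by blast
  qed
  ultimately show "let c = Poly_Mapping.lookup ?x; w' = psi T in
      ?x = (\<Sum>w\<in>webs n. c w *\<^sub>c basis_vec w) \<and> c w' = 1 \<and> (\<forall>w \<in> webs n. (w, w') \<notin> r \<longrightarrow> c w = 0)"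
    using lead unfolding Let_def leading_def by blast
qed

end
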